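(* Let $0<u<v$ and $s\in(0,1]$. Then $$2\left|\frac{s+1}{2}L_s^s(u,v)+\frac12 A^s(u,v)-L_s^s(u,v)\right|=\left|(s-1)L_s^s(u,v)+A^s(u,v)\right|$$ $$\le \frac{s}{s+1}A^s(u,v)+\frac{s}{s+2}A(u^s,v^s)+\frac{s\,G^2(u,v)}{(s+1)(s+2)}A(u^{s-2},v^{s-2}).$$
   Context: For $a,b>0$: $A(a,b)=\frac{a+b}{2}$ is the arithmetic mean, $G(a,b)=\sqrt{ab}$ is the geometric mean, and, for $a\ne b$ and $p\in\mathbb{R}\setminus\{-1,0\}$, $L_p(a,b)=\left(\frac{b^{p+1}-a^{p+1}}{(p+1)(b-a)}\right)^{1/p}$ is the generalized logarithmic mean. Notation: $A^s(u,v)=(A(u,v))^s$, $G^2(u,v)=(G(u,v))^2$, $L_s^s(u,v)=(L_s(u,v))^s=\frac{v^{s+1}-u^{s+1}}{(s+1)(v-u)}$. *)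

theory Defs
  imports Complex_Main
begin

definition arith_mean :: "real \<Rightarrow> real \<Rightarrow> real" where
  "arith_mean a b = (a + b) / 2"

definition geom_mean :: "real \<Rightarrow> real \<Rightarrow> real" where
  "geom_mean a b = sqrt (a * b)"

(* Meaningful for a, b > 0, a \<noteq> b and p \<notin> {-1, 0}. *)
definition gen_log_mean :: "real \<Rightarrow> real \<Rightarrow> real \<Rightarrow> real" where
  "gen_log_mean p a b =
     ((b powr (p + 1) - a powr (p + 1)) / ((p + 1) * (b - a))) powr (1 / p)"

end

theory Submission
  imports Defs "HOL-Analysis.Convex"
begin

text \<open>
  Put \<open>m = (u + v) / 2\<close>, \<open>M = m powr s\<close>, and let \<open>L\<close> be the \<open>s\<close>-th power of the logarithmic
  mean, that is, the average of \<open>x powr s\<close> over the interval from \<open>u\<close> to \<open>v\<close>. The first claim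
  is only \<open>2 * ((s + 1) / 2 - 1) = s - 1\<close>. For the second, \<open>L\<close> is at most \<open>v powr s\<close>, hence at
  most \<open>(1 + s) * M\<close>, so that \<open>M - (1 - s) * L\<close> is nonnegative and the absolute value can be
  dropped. What remains is an upper bound for \<open>M - (1 - s) * L\<close>, which needs lower bounds,
  in multiples of \<open>M\<close>, for \<open>L\<close> and for the two terms
  \<open>P = (u powr s + v powr s) / 2\<close> and
  \<open>Q = u * v * (u powr (s - 2) + v powr (s - 2)) / 2\<close> on the right-hand side.

  Concavity of \<open>x powr s\<close> makes \<open>L\<close> and \<open>P\<close>, for a given \<open>u + v\<close>, smallest in the limit
  \<open>u = 0\<close>: \<open>L \<ge> (u + v) powr s / (s + 1)\<close> and \<open>P \<ge> (u + v) powr s / 2\<close>. The sum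
  \<open>P + Q\<close> equals \<open>m * (u powr (s - 1) + v powr (s - 1))\<close>, and convexity of \<open>x powr (s - 1)\<close>
  gives \<open>P + Q \<ge> 2 * M\<close>. Finally \<open>(u + v) powr s = 2 powr s * M \<ge> 2 / (2 - s) * M\<close>. Once these
  bounds are inserted, \<open>M\<close> cancels and the claim becomes the polynomial inequality
  \<open>4 - s\<^sup>2 \<le> 4 + 2 * s - 3 * s\<^sup>2\<close>, which holds on the unit interval and is sharp at both ends.
\<close>

lemma powr_concave:
  fixes p :: real
  assumes "0 \<le> p" "p \<le> 1"
  shows "concave_on {0<..} (\<lambda>x. x powr p)"
proof (rule f''_le0_imp_concave)
  fix x :: real
  assume "x \<in> {0<..}"
  then have x: "0 < x" by simp
  show "((\<lambda>x. x powr p) has_real_derivative p * x powr (p - 1)) (at x)"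
    using x by (auto intro!: derivative_eq_intros)
  show "((\<lambda>x. p * x powr (p - 1)) has_real_derivative p * ((p - 1) * x powr (p - 2))) (at x)"
    using x by (auto intro!: derivative_eq_intros)
  show "p * ((p - 1) * x powr (p - 2)) \<le> 0"
    using assms by (intro mult_nonneg_nonpos mult_nonpos_nonneg) auto
qed simp

lemma powr_convex_nonpos:
  fixes p :: real
  assumes "p \<le> 0"
  shows "convex_on {0<..} (\<lambda>x. x powr p)"
proof (rule f''_ge0_imp_convex)
  fix x :: real
  assume "x \<in> {0<..}"
  then have x: "0 < x" by simp
  show "((\<lambda>x. x powr p) has_real_derivative p * x powr (p - 1)) (at x)"
    using x by (auto intro!: derivative_eq_intros)
  show "((\<lambda>x. p * x powr (p - 1)) has_real_derivative p * ((p - 1) * x powr (p - 2))) (at x)"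
    using x by (auto intro!: derivative_eq_intros)
  show "0 \<le> p * ((p - 1) * x powr (p - 2))"
    using assms by (intro mult_nonpos_nonpos mult_nonpos_nonneg) auto
qed simp

text \<open>
  Bernoulli's inequality for exponents in the unit interval: the concave power function lies below
  its tangent at 1. It is Young's inequality with second factor 1.
\<close>

lemma powr_le_tangent_at_1:
  fixes s x :: real
  assumes "0 \<le> s" "s \<le> 1" "0 < x"
  shows "x powr s \<le> 1 + s * (x - 1)"
  using Youngs_inequality_0[of s "1 - s" x 1] assms by (simp add: algebra_simps)

text \<open>
  The point \<open>v\<close> is the convex combination of \<open>u\<close> and \<open>u + v\<close> with weights \<open>u / v\<close> and
  \<open>(v - u) / v\<close>; concavity at this point, multiplied by \<open>v\<close>, is the claim.
\<close>

lemma powr_succ_diff_ge: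
  fixes u v s :: real
  assumes "0 < u" "u < v" "0 \<le> s" "s \<le> 1"
  shows "(v - u) * (u + v) powr s \<le> v powr (s + 1) - u powr (s + 1)"
proof -
  define t where "t = (v - u) / v"
  have t: "0 \<le> t" "t \<le> 1" "v * t = v - u" "v * (1 - t) = u"
    using assms by (auto simp: t_def field_simps)
  have "v * ((1 - t) * u + t * (u + v)) = (v * (1 - t)) * u + (v * t) * (u + v)"
    by (simp add: algebra_simps)
  also have "\<dots> = u * u + (v - u) * (u + v)"
    by (simp only: t)
  also have "\<dots> = v * v"
    by (simp add: algebra_simps)
  finally have pt: "(1 - t) * u + t * (u + v) = v"
    using assms by simp
  have "(1 - t) * u powr s + t * (u + v) powr s \<le> v powr s"
    using concave_onD[OF powr_concave[OF assms(3,4)] t(1,2), of u "u + v"] assms pt by simp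
  then have "v * ((1 - t) * u powr s + t * (u + v) powr s) \<le> v * v powr s"
    using assms by (intro mult_left_mono) auto
  also have "v * ((1 - t) * u powr s + t * (u + v) powr s)
      = (v * (1 - t)) * u powr s + (v * t) * (u + v) powr s"
    by (simp add: algebra_simps)
  also have "\<dots> = u * u powr s + (v - u) * (u + v) powr s"
    by (simp only: t)
  finally show ?thesis
    using assms by (simp add: powr_add mult.commute)
qed

text \<open>
  This is the mean value bound for \<open>x powr (s + 1)\<close>, whose derivative on the interval from
  \<open>u\<close> to \<open>v\<close> is largest at \<open>v\<close>. Writing the difference of the powers as \<open>(v - u) * v powr s + u * (v powr s - u powr s)\<close> leaves only the second summand to
  be estimated, for which the tangent bound at \<open>v / u\<close> suffices.
\<close>

lemma powr_succ_diff_le: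
  fixes u v s :: real
  assumes "0 < u" "u < v" "0 \<le> s" "s \<le> 1"
  shows "v powr (s + 1) - u powr (s + 1) \<le> (s + 1) * (v - u) * v powr s"
proof -
  have "v powr s = u powr s * (v / u) powr s"
    using assms by (simp add: powr_divide)
  also have "\<dots> \<le> u powr s * (1 + s * (v / u - 1))"
    using assms by (intro mult_left_mono powr_le_tangent_at_1) auto
  finally have "u * v powr s \<le> u * (u powr s * (1 + s * (v / u - 1)))"
    using assms by (intro mult_left_mono) auto
  also have "\<dots> = u * u powr s + s * (v - u) * u powr s"
    using assms by (simp add: field_simps)
  also have "\<dots> \<le> u * u powr s + s * (v - u) * v powr s"
    using assms by (intro add_left_mono mult_left_mono powr_mono2) auto
  finally have "u * v powr s - u * u powr s \<le> s * (v - u) * v powr s"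
    by simp
  then show ?thesis
    using assms by (simp add: powr_add algebra_simps)
qed

text \<open>
  Since the exponent \<open>s - 1\<close> is at most 0, replacing \<open>u\<close> or \<open>v\<close> by \<open>u + v\<close> inside the powers of
  \<open>u * u powr (s - 1) + v * v powr (s - 1)\<close> can only decrease this sum, and turns it into
  \<open>(u + v) powr s\<close>.
\<close>

lemma powr_subadditive:
  fixes u v s :: real
  assumes "0 < u" "0 < v" "s \<le> 1"
  shows "(u + v) powr s \<le> u powr s + v powr s"
proof -
  have split: "x powr s = x * x powr (s - 1)" if "0 < x" for x :: real
    using that by (simp add: powr_diff)
  have "(u + v) powr s = u * (u + v) powr (s - 1) + v * (u + v) powr (s - 1)"
    using split[of "u + v"] assms by (simp add: algebra_simps)
  also have "\<dots> \<le> u * u powr (s - 1) + v * v powr (s - 1)"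
    using assms by (intro add_mono mult_left_mono powr_mono2') auto
  finally show ?thesis
    using split assms by simp
qed

text \<open>
  The right-hand side is the sum \<open>P + Q\<close> of the overview: it factors as the midpoint
  times \<open>u powr (s - 1) + v powr (s - 1)\<close>, to which midpoint convexity applies.
\<close>

lemma arith_mean_powr_add_ge:
  fixes u v s :: real
  assumes "0 < u" "0 < v" "s \<le> 1"
  shows "2 * arith_mean u v powr s
    \<le> arith_mean (u powr s) (v powr s) + u * v * arith_mean (u powr (s - 2)) (v powr (s - 2))"
proof -
  define m where "m = arith_mean u v"
  have m: "0 < m" "u + v = 2 * m"
    using assms by (auto simp: m_def arith_mean_def)
  have lower: "x powr s = x * x powr (s - 1)" "x * x powr (s - 2) = x powr (s - 1)"
    if "0 < x" for x :: real
    using that powr_add[of x 1 "s - 1"] powr_add[of x 1 "s - 2"] by auto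
  have "m powr (s - 1) \<le> (u powr (s - 1) + v powr (s - 1)) / 2"
    using convex_onD[OF powr_convex_nonpos[of "s - 1"], of "1/2" u v] assms
    by (simp add: m_def arith_mean_def add_divide_distrib)
  then have "2 * (m * m powr (s - 1)) \<le> m * (u powr (s - 1) + v powr (s - 1))"
    using m by simp
  also have "\<dots> = (u + v) * (u powr (s - 1) + v powr (s - 1)) / 2"
    by (simp add: m)
  also have "\<dots> = (u * u powr (s - 1) + v * v powr (s - 1)) / 2
      + (v * (u * u powr (s - 2)) + u * (v * v powr (s - 2))) / 2"
    using lower(2) assms by (simp add: algebra_simps add_divide_distrib)
  also have "\<dots> = arith_mean (u powr s) (v powr s)
      + u * v * arith_mean (u powr (s - 2)) (v powr (s - 2))"
    using lower(1) assms by (simp add: arith_mean_def algebra_simps)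
  finally show ?thesis
    using lower(1)[OF m(1)] by (simp add: m_def)
qed

text \<open>
  The two lemmas estimate \<open>2 powr s\<close> on the unit interval from above by the tangent bound at 2, and
  from below through the tangent bound for \<open>(1/2) powr s\<close>; both are equalities at 0 and 1.
\<close>

lemma two_powr_le:
  fixes s :: real
  assumes "0 \<le> s" "s \<le> 1"
  shows "2 powr s \<le> 1 + s"
  using powr_le_tangent_at_1[of s 2] assms by simp

lemma two_powr_ge:
  fixes s :: real
  assumes "0 \<le> s" "s \<le> 1"
  shows "2 / (2 - s) \<le> 2 powr s"
proof -
  have "1 / 2 powr s \<le> (2 - s) / 2"
    using powr_le_tangent_at_1[of s "1/2"] assms by (simp add: powr_divide field_simps)
  then show ?thesis
    using assms by (simp add: field_simps)
qed

text \<open>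
  The power cancels the root in the definition of the mean because the quotient under the root is
  nonnegative.
\<close>

lemma gen_log_mean_powr:
  fixes u v s :: real
  assumes "0 < u" "u < v" "0 < s"
  shows "gen_log_mean s u v powr s = (v powr (s + 1) - u powr (s + 1)) / ((s + 1) * (v - u))"
proof -
  have "u powr (s + 1) < v powr (s + 1)"
    using assms by (intro powr_less_mono2) auto
  then show ?thesis
    using assms by (simp add: gen_log_mean_def powr_powr)
qed

theorem proposition1:
  fixes u v s :: real
  assumes "0 < u" and "u < v" and "0 < s" and "s \<le> 1"
  shows "2 * \<bar>(s + 1) / 2 * gen_log_mean s u v powr s + 1 / 2 * arith_mean u v powr s
              - gen_log_mean s u v powr s\<bar>
           = \<bar>(s - 1) * gen_log_mean s u v powr s + arith_mean u v powr s\<bar>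
       \<and> \<bar>(s - 1) * gen_log_mean s u v powr s + arith_mean u v powr s\<bar>
           \<le> s / (s + 1) * arith_mean u v powr s
             + s / (s + 2) * arith_mean (u powr s) (v powr s)
             + s * (geom_mean u v)\<^sup>2 / ((s + 1) * (s + 2))
                 * arith_mean (u powr (s - 2)) (v powr (s - 2))"
proof -
  define M where "M = arith_mean u v powr s"
  define L where "L = gen_log_mean s u v powr s"
  define P where "P = arith_mean (u powr s) (v powr s)"
  define Q where "Q = u * v * arith_mean (u powr (s - 2)) (v powr (s - 2))"
  have M: "0 < M"
    using assms by (simp add: M_def arith_mean_def)
  have double: "(u + v) powr s = 2 powr s * M"
    using assms by (simp add: M_def arith_mean_def powr_divide)
  have L_eq: "L = (v powr (s + 1) - u powr (s + 1)) / ((s + 1) * (v - u))"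
    unfolding L_def using assms by (intro gen_log_mean_powr) auto
  have "L \<le> v powr s"
    using powr_succ_diff_le[of u v s] assms by (simp add: L_eq pos_divide_le_eq mult.commute)
  also have "\<dots> \<le> (u + v) powr s"
    using assms by (intro powr_mono2) auto
  also have "\<dots> \<le> (1 + s) * M"
    using two_powr_le[of s] assms M by (simp add: double)
  finally have "(1 - s) * L \<le> (1 - s) * ((1 + s) * M)"
    using assms by (intro mult_left_mono) auto
  also have "\<dots> \<le> M"
    using M by (simp add: algebra_simps)
  finally have nonneg: "0 \<le> (s - 1) * L + M"
    by (simp add: algebra_simps)

  have dbl_ge: "2 / (2 - s) * M \<le> (u + v) powr s"
    unfolding double using two_powr_ge[of s] assms M by (intro mult_right_mono) auto
  have "(u + v) powr s \<le> (v powr (s + 1) - u powr (s + 1)) / (v - u)"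
    using powr_succ_diff_ge[of u v s] assms by (simp add: pos_le_divide_eq mult.commute)
  also have "\<dots> = L * (s + 1)"
    using assms by (simp add: L_eq)
  finally have "(u + v) powr s / (s + 1) \<le> L"
    using assms by (simp add: pos_divide_le_eq)
  then have L_ge: "2 / (2 - s) * M / (s + 1) \<le> L"
    using divide_right_mono[OF dbl_ge, of "s + 1"] assms by linarith
  have P_ge: "M / (2 - s) \<le> P"
    using dbl_ge powr_subadditive[of u v s] assms by (simp add: P_def arith_mean_def mult.commute)
  have PQ_ge: "2 * M \<le> P + Q"
    unfolding M_def P_def Q_def using assms by (intro arith_mean_powr_add_ge) auto

  \<comment> \<open>The inequality that is left for \<open>M\<close>, divided by \<open>M\<close>.\<close>
  have poly: "1 / (s + 1) \<le> (1 - s) * (2 / (2 - s) / (s + 1))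
      + s / ((s + 1) * (s + 2)) * (s / (2 - s) + 2)"
  proof -
    have "(1 - s) * (2 / (2 - s) / (s + 1)) + s / ((s + 1) * (s + 2)) * (s / (2 - s) + 2)
        - 1 / (s + 1) = 2 * s * (1 - s) / ((s + 1) * (s + 2) * (2 - s))"
    proof -
      have "s + 1 \<noteq> 0" "s + 2 \<noteq> 0" "2 - s \<noteq> 0" using assms by auto
      then show ?thesis by (simp add: divide_simps) (simp add: algebra_simps)
    qed
    also have "\<dots> \<ge> 0" using assms by simp
    finally show ?thesis by simp
  qed
  have "M / (s + 1) \<le> (1 - s) * (2 / (2 - s) * M / (s + 1))
      + s / ((s + 1) * (s + 2)) * (s * (M / (2 - s)) + 2 * M)"
    using mult_right_mono[OF poly, of M] M by (simp add: algebra_simps)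
  also have "\<dots> \<le> (1 - s) * L + s / ((s + 1) * (s + 2)) * (s * P + (P + Q))"
    using L_ge P_ge PQ_ge assms by (intro add_mono mult_left_mono) auto
  also have "s / ((s + 1) * (s + 2)) * (s * P + (P + Q))
      = s / (s + 2) * P + s / ((s + 1) * (s + 2)) * Q"
  proof -
    have "s + 1 \<noteq> 0" "s + 2 \<noteq> 0" using assms by auto
    then show ?thesis by (simp add: divide_simps) (simp add: algebra_simps)
  qed
  finally have "M / (s + 1) \<le> (1 - s) * L + (s / (s + 2) * P + s / ((s + 1) * (s + 2)) * Q)" .
  moreover have "s / (s + 1) = 1 - 1 / (s + 1)"
    using assms by (simp add: field_simps)
  then have "M = s / (s + 1) * M + M / (s + 1)"
    by (simp add: left_diff_distrib)
  ultimately have "(s - 1) * L + M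
      \<le> s / (s + 1) * M + s / (s + 2) * P + s / ((s + 1) * (s + 2)) * Q"
    by (simp add: algebra_simps)
  moreover have "s * (geom_mean u v)\<^sup>2 / ((s + 1) * (s + 2))
        * arith_mean (u powr (s - 2)) (v powr (s - 2)) = s / ((s + 1) * (s + 2)) * Q"
    using assms by (simp add: geom_mean_def Q_def)
  moreover have "2 * \<bar>(s + 1) / 2 * L + 1 / 2 * M - L\<bar> = \<bar>(s - 1) * L + M\<bar>"
  proof -
    have "(s - 1) * L + M = 2 * ((s + 1) / 2 * L + 1 / 2 * M - L)"
      by (simp add: field_simps)
    then show ?thesis
      by (simp only: abs_mult abs_numeral)
  qed
  ultimately show ?thesis
    using nonneg by (simp only: abs_of_nonneg flip: M_def L_def P_def)
qed

end
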